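(* Let $h(z)=z+\sum_{n=2}^{\infty}a_nz^n$ and $g(z)=\sum_{n=1}^{\infty}b_nz^n$ be analytic in $\mathbb{D}$, and suppose that $$|a_n|\le \frac{n+1}{2}\quad\text{and}\quad |b_n|\le \frac{n-1}{2}\qquad\text{for all } n\ge 1,$$ where $a_1=1$. Then $f=h+\overline{g}$ is close-to-convex (in particular univalent), and starlike, in the disk $|z|<r_S$, where $$r_S=1+\frac{\sqrt[3]{-18+\sqrt{330}}}{6^{2/3}}-\frac{1}{\sqrt[3]{6(-18+\sqrt{330})}}\approx 0.164878$$ is the real root of the cubic equation $$2r^3-6r^2+7r-1=0$$ in the interval $(0,1)$. The result is sharp: $r_S$ cannot be replaced by any larger number, i.e. for every $r\in(r_S,1]$ there are $h,g$ satisfying the hypotheses for which $f=h+\overline{g}$ is not univalent in $|z|<r$.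
   Context: $\mathbb{D}=\{z\in\mathbb{C}:|z|<1\}$. A domain $\Omega\subset\mathbb{C}$ is close-to-convex if its complement $\mathbb{C}\setminus\Omega$ is a union of closed half-lines whose interiors (open half-lines) are pairwise disjoint. A complex-valued harmonic function $f$ is called close-to-convex (resp. starlike) in a disk $|z|<r$ if it is univalent (injective) and sense-preserving there and maps that disk onto a close-to-convex domain (resp. onto a domain starlike with respect to the origin). *)

theory Defs
  imports "HOL-Analysis.Analysis"
begin

definition closed_half_line :: "complex \<Rightarrow> complex \<Rightarrow> complex set" where
  "closed_half_line p d = {p + of_real t * d | t::real. t \<ge> 0}"

definition open_half_line :: "complex \<Rightarrow> complex \<Rightarrow> complex set" where
  "open_half_line p d = {p + of_real t * d | t::real. t > 0}"

(* A family of half-lines is a set L of pairs (endpoint, unit direction); the normalisation makes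
   the pair determined by its half-line.  The family may be empty, so the whole plane qualifies. *)
definition close_to_convex_domain :: "complex set \<Rightarrow> bool" where
  "close_to_convex_domain \<Omega> \<longleftrightarrow>
     open \<Omega> \<and> connected \<Omega> \<and> \<Omega> \<noteq> {} \<and>
     (\<exists>L :: (complex \<times> complex) set.
        (\<forall>(p, d)\<in>L. norm d = 1) \<and>
        disjoint_family_on (\<lambda>(p, d). open_half_line p d) L \<and>
        - \<Omega> = (\<Union>(p, d)\<in>L. closed_half_line p d))"

(* The library's "starlike" leaves the centre existentially quantified. *)
definition starlike_domain_wrt_0 :: "complex set \<Rightarrow> bool" where
  "starlike_domain_wrt_0 \<Omega> \<longleftrightarrow>
     open \<Omega> \<and> connected \<Omega> \<and> 0 \<in> \<Omega> \<and> (\<forall>w\<in>\<Omega>. closed_segment 0 w \<subseteq> \<Omega>)"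

(* C^2 with vanishing Laplacian; fx, fy, fxx, ... are the partial derivatives in x = Re z, y = Im z. *)
definition harmonic_fun_on :: "(complex \<Rightarrow> complex) \<Rightarrow> complex set \<Rightarrow> bool" where
  "harmonic_fun_on f S \<longleftrightarrow>
     (\<exists>fx fy fxx fxy fyx fyy :: complex \<Rightarrow> complex.
        (\<forall>z\<in>S. (f has_derivative (\<lambda>v. Re v *\<^sub>R fx z + Im v *\<^sub>R fy z)) (at z) \<and>
               (fx has_derivative (\<lambda>v. Re v *\<^sub>R fxx z + Im v *\<^sub>R fxy z)) (at z) \<and>
               (fy has_derivative (\<lambda>v. Re v *\<^sub>R fyx z + Im v *\<^sub>R fyy z)) (at z) \<and>
               fxx z + fyy z = 0) \<and>
        continuous_on S fxx \<and> continuous_on S fxy \<and>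
        continuous_on S fyx \<and> continuous_on S fyy)"

(* u_x v_y - v_x u_y for f = u + i v *)
definition jacobian_det :: "(complex \<Rightarrow> complex) \<Rightarrow> complex \<Rightarrow> real" where
  "jacobian_det f z =
     (let fx = frechet_derivative f (at z) 1; fy = frechet_derivative f (at z) \<i>
      in Re fx * Im fy - Im fx * Re fy)"

definition sense_preserving_on :: "(complex \<Rightarrow> complex) \<Rightarrow> complex set \<Rightarrow> bool" where
  "sense_preserving_on f S \<longleftrightarrow> (\<forall>z\<in>S. f differentiable (at z) \<and> jacobian_det f z > 0)"

definition close_to_convex_in_disk :: "(complex \<Rightarrow> complex) \<Rightarrow> real \<Rightarrow> bool" where
  "close_to_convex_in_disk f r \<longleftrightarrow>
     harmonic_fun_on f (ball 0 r) \<and> inj_on f (ball 0 r) \<and> sense_preserving_on f (ball 0 r) \<and>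
     close_to_convex_domain (f ` ball 0 r)"

definition starlike_in_disk :: "(complex \<Rightarrow> complex) \<Rightarrow> real \<Rightarrow> bool" where
  "starlike_in_disk f r \<longleftrightarrow>
     harmonic_fun_on f (ball 0 r) \<and> inj_on f (ball 0 r) \<and> sense_preserving_on f (ball 0 r) \<and>
     starlike_domain_wrt_0 (f ` ball 0 r)"

(* Both series start at n = 1 (the bounds say nothing about index 0); for n = 1 they force
   b 1 = 0. *)
definition coeff_bounded_pair :: "(complex \<Rightarrow> complex) \<Rightarrow> (complex \<Rightarrow> complex) \<Rightarrow> bool" where
  "coeff_bounded_pair h g \<longleftrightarrow>
     h analytic_on ball 0 1 \<and> g analytic_on ball 0 1 \<and>
     (\<exists>a b :: nat \<Rightarrow> complex.
        a 1 = 1 \<and>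
        (\<forall>z\<in>ball 0 1. (\<lambda>n. a (Suc n) * z ^ Suc n) sums h z) \<and>
        (\<forall>z\<in>ball 0 1. (\<lambda>n. b (Suc n) * z ^ Suc n) sums g z) \<and>
        (\<forall>n\<ge>1. norm (a n) \<le> (real n + 1) / 2 \<and> norm (b n) \<le> (real n - 1) / 2))"

definition r_S :: real where
  "r_S = 1 + root 3 (- 18 + sqrt 330) / 6 powr (2 / 3) - 1 / root 3 (6 * (- 18 + sqrt 330))"

end

theory Submission
  imports Defs "HOL-Complex_Analysis.Complex_Analysis"
begin

text \<open>With \<open>a\<^sub>n\<close>, \<open>b\<^sub>n\<close> the coefficients of \<open>h\<close> and \<open>g\<close>, everything follows from one inequality
  together with \<open>a\<^sub>1 = 1\<close> and \<open>b\<^sub>1 = 0\<close>: the sum \<open>\<Sum>n\<ge>2. n (\<bar>a\<^sub>n\<bar> + \<bar>b\<^sub>n\<bar>) \<rho>\<^sup>n\<^sup>-\<^sup>1\<close> is below \<open>1\<close> for every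
  \<open>\<rho> < r\<close>. Under the coefficient bounds \<open>b\<^sub>1\<close> vanishes and the sum is at most \<open>\<Sum>n\<ge>2. n\<^sup>2 \<rho>\<^sup>n\<^sup>-\<^sup>1 = (1 + \<rho>)/(1 - \<rho>)\<^sup>3 - 1\<close>,
  which stays below \<open>1\<close> exactly up to the root of the cubic (\<open>extremal_majorant\<close>).

  The inequality says that \<open>f = h + cnj g\<close> is the identity plus a contraction on smaller disks, hence
  injective and sense-preserving, and also that \<open>Re (f cnj v) > 0\<close> off the origin for
  \<open>v = z h' - cnj (z g')\<close>, that is, the argument of \<open>f\<close> increases along circles
  (\<open>small_coefficients_imp_starlike\<close>).

  Starlikeness of the image is a statement about pulling back radial segments. Following the
  segment from \<open>f(z)\<close> towards \<open>0\<close>, the preimage can only move into the disk of radius \<open>\<bar>z\<bar>\<close>, by the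
  inverse function theorem and the sign condition (\<open>radial_step_stays_in_disk\<close>). The set of
  parameters whose point lies in the image of the closed disk is therefore closed and extends to the left of
  each positive element, so it is everything (\<open>starlike_image_add_cnj\<close>). A starlike domain is
  close-to-convex, because its complement is a union of radial rays
  (\<open>starlike_imp_close_to_convex_domain\<close>).

  For sharpness, take the coefficients of the largest moduli and with signs for which \<open>f\<close> is
  \<open>2x - x/(1 - x)\<^sup>2\<close> on the real axis; this function turns back at the radius
  (\<open>extremal_not_inj\<close>).\<close>

section \<open>Harmonic maps and their differential\<close>

lemma has_derivative_add_cnj:
  assumes "(h has_field_derivative h') (at z)" "(g has_field_derivative g') (at z)"
  shows "((\<lambda>z. h z + cnj (g z)) has_derivative (\<lambda>v. h' * v + cnj (g' * v))) (at z)"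
  using assms unfolding has_field_derivative_def
  by (intro has_derivative_add has_derivative_cnj)

lemma harmonic_fun_on_add_cnj:
  assumes S: "open S" and h: "h holomorphic_on S" and g: "g holomorphic_on S"
  shows "harmonic_fun_on (\<lambda>z. h z + cnj (g z)) S"
proof -
  let ?h' = "deriv h" and ?g' = "deriv g"
  let ?h'' = "deriv (deriv h)" and ?g'' = "deriv (deriv g)"
  have h': "?h' holomorphic_on S" and g': "?g' holomorphic_on S"
    using assms by (auto intro: holomorphic_deriv)
  have h'': "continuous_on S ?h''" and g'': "continuous_on S ?g''"
    using h' g' S by (auto intro: holomorphic_deriv holomorphic_on_imp_continuous_on)
  have D: "(h has_field_derivative ?h' z) (at z)" "(g has_field_derivative ?g' z) (at z)"
          "(?h' has_field_derivative ?h'' z) (at z)" "(?g' has_field_derivative ?g'' z) (at z)"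
    if "z \<in> S" for z
    using that h g h' g' S by (auto intro: holomorphic_derivI)
  \<comment> \<open>A real-linear map of the form \<open>v \<mapsto> a v + cnj (b v)\<close> is determined by its values at \<open>1\<close> and \<open>\<i>\<close>.\<close>
  have split: "(\<lambda>v. a * v + cnj (b * v)) = (\<lambda>v. Re v *\<^sub>R (a + cnj b) + Im v *\<^sub>R (\<i> * a + cnj (\<i> * b)))"
    for a b by (auto simp: complex_eq_iff algebra_simps)
  have E: "((\<lambda>z. h z + cnj (g z)) has_derivative
              (\<lambda>v. Re v *\<^sub>R (?h' z + cnj (?g' z)) + Im v *\<^sub>R (\<i> * ?h' z + cnj (\<i> * ?g' z)))) (at z)"
          "((\<lambda>z. ?h' z + cnj (?g' z)) has_derivative
              (\<lambda>v. Re v *\<^sub>R (?h'' z + cnj (?g'' z)) + Im v *\<^sub>R (\<i> * ?h'' z + cnj (\<i> * ?g'' z)))) (at z)"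
          "((\<lambda>z. \<i> * ?h' z + cnj (\<i> * ?g' z)) has_derivative
              (\<lambda>v. Re v *\<^sub>R (\<i> * ?h'' z + cnj (\<i> * ?g'' z)) +
                   Im v *\<^sub>R (\<i> * (\<i> * ?h'' z) + cnj (\<i> * (\<i> * ?g'' z))))) (at z)"
    if z: "z \<in> S" for z
    unfolding split[symmetric]
    by (intro has_derivative_add_cnj DERIV_cmult D[OF z])+
  show ?thesis
    unfolding harmonic_fun_on_def
    by (rule exI[of _ "\<lambda>z. ?h' z + cnj (?g' z)"],
        rule exI[of _ "\<lambda>z. \<i> * ?h' z + cnj (\<i> * ?g' z)"],
        rule exI[of _ "\<lambda>z. ?h'' z + cnj (?g'' z)"],
        rule exI[of _ "\<lambda>z. \<i> * ?h'' z + cnj (\<i> * ?g'' z)"],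
        rule exI[of _ "\<lambda>z. \<i> * ?h'' z + cnj (\<i> * ?g'' z)"],
        rule exI[of _ "\<lambda>z. \<i> * (\<i> * ?h'' z) + cnj (\<i> * (\<i> * ?g'' z))"],
        intro conjI ballI E continuous_intros h'' g'')
       (auto simp: algebra_simps)
qed

lemma sense_preserving_add_cnj:
  assumes D: "(f has_derivative (\<lambda>v. a * v + cnj (b * v))) (at z)" and less: "norm b < norm a"
  shows "f differentiable (at z)" "jacobian_det f z > 0"
proof -
  show "f differentiable (at z)"
    using D by (auto simp: differentiable_def)
  have eq: "frechet_derivative f (at z) = (\<lambda>v. a * v + cnj (b * v))"
    using frechet_derivative_at[OF D] by simp
  have "(norm b)\<^sup>2 < (norm a)\<^sup>2"
    using less by (intro power_strict_mono) auto
  then show "jacobian_det f z > 0"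
    unfolding jacobian_det_def Let_def eq cmod_power2
    by (simp add: algebra_simps power2_eq_square)
qed

section \<open>Starlike images\<close>

lemma inverse_add_cnj:
  fixes a b :: complex
  assumes "norm b < norm a"
  shows "(\<lambda>v. a * v + cnj (b * v)) \<circ>
           (\<lambda>w. (cnj a * w - cnj (b * w)) / of_real ((norm a)\<^sup>2 - (norm b)\<^sup>2)) = id"
proof -
  let ?J = "complex_of_real ((norm a)\<^sup>2 - (norm b)\<^sup>2)"
  have "(norm b)\<^sup>2 < (norm a)\<^sup>2"
    using assms by (intro power_strict_mono) auto
  then have ne: "?J \<noteq> 0"
    by (metis diff_gt_0_iff_gt less_irrefl of_real_eq_0_iff)
  have eq: "?J = a * cnj a - b * cnj b"
    by (simp add: complex_norm_square[symmetric])
  have "a * ((cnj a * w - cnj (b * w)) / ?J) + cnj (b * ((cnj a * w - cnj (b * w)) / ?J)) = w" for w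
  proof -
    have "?J * w = (a * cnj a - b * cnj b) * w" by (simp only: eq)
    also have "\<dots> = a * (cnj a * w - cnj (b * w)) + cnj (b * (cnj a * w - cnj (b * w)))"
      by (simp add: algebra_simps)
    finally show ?thesis using ne by (simp add: add_divide_distrib[symmetric] field_simps)
  qed
  then show ?thesis by (auto simp: fun_eq_iff)
qed

text \<open>The hypothesis on the real part says that the argument of \<open>f\<close> increases along circles, or,
  equivalently, that the preimage of the radial segment towards \<open>0\<close> leaves \<open>z\<close> into the disk
  \<open>\<bar>\<zeta>\<bar> < \<bar>z\<bar>\<close>: the derivative of \<open>\<bar>f\<inverse>(s f(z))\<bar>\<^sup>2\<close> at \<open>s = 1\<close> is a positive multiple of that real part.\<close>

lemma radial_step_stays_in_disk:
  fixes f :: "complex \<Rightarrow> complex"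
  assumes U: "open U" "z \<in> U" and inj: "inj_on f U" and cont: "continuous_on U f"
    and D: "(f has_derivative (\<lambda>v. a * v + cnj (b * v))) (at z)" and less: "norm b < norm a"
    and star: "Re (f z * cnj (z * a - cnj (z * b))) > 0"
  shows "\<exists>e>0. \<forall>s. 1 - e < s \<and> s < 1 \<longrightarrow> of_real s * f z \<in> f ` (U \<inter> ball 0 (norm z))"
proof -
  define \<phi> where "\<phi> = the_inv_into U f"
  have \<phi>f: "\<phi> (f x) = x" if "x \<in> U" for x
    using that inj by (simp add: \<phi>_def the_inv_into_f_f)
  define J where "J = (norm a)\<^sup>2 - (norm b)\<^sup>2"
  have J: "J > 0" unfolding J_def using less by (simp add: power_strict_mono)
  define \<phi>' where "\<phi>' = (\<lambda>w. (cnj a * w - cnj (b * w)) / of_real J)"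
  have D\<phi>: "(\<phi> has_derivative \<phi>') (at (f z))"
    using has_derivative_inverse_strong[OF U cont \<phi>f D inverse_add_cnj[OF less]]
    unfolding \<phi>'_def J_def by simp
  define c where "c = (\<lambda>s::real. \<phi> (of_real s * f z))"
  have D\<phi>1: "(\<phi> has_derivative \<phi>') (at (of_real 1 * f z))" using D\<phi> by simp
  have line: "((\<lambda>s::real. of_real s * f z) has_derivative (\<lambda>s. of_real s * f z)) (at 1)"
    by (auto intro!: derivative_eq_intros)
  have "(c has_derivative (\<lambda>s. \<phi>' (of_real s * f z))) (at 1)"
    using has_derivative_compose[OF line D\<phi>1] by (simp add: c_def)
  moreover have "\<phi>' (of_real s * f z) = s *\<^sub>R \<phi>' (f z)" for s
    by (simp add: \<phi>'_def scaleR_conv_of_real algebra_simps diff_divide_distrib)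
  ultimately have c': "(c has_vector_derivative \<phi>' (f z)) (at 1)"
    by (simp add: has_vector_derivative_def)
  have c1: "c 1 = z" using \<phi>f U by (simp add: c_def)
  have "((\<lambda>s. c s \<bullet> c s) has_derivative
          (\<lambda>s. c 1 \<bullet> (s *\<^sub>R \<phi>' (f z)) + (s *\<^sub>R \<phi>' (f z)) \<bullet> c 1)) (at 1)"
    using c' unfolding has_vector_derivative_def by (intro has_derivative_inner)
  then have c2: "((\<lambda>s. c s \<bullet> c s) has_real_derivative 2 * (z \<bullet> \<phi>' (f z))) (at 1)"
    unfolding has_field_derivative_def
    by (rule has_derivative_eq_rhs) (auto simp: c1 inner_commute)
  have "J * (z \<bullet> \<phi>' (f z)) = Re (f z * cnj (z * a - cnj (z * b)))"
    using J by (simp add: \<phi>'_def inner_complex_def field_simps)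
  then have "z \<bullet> \<phi>' (f z) > 0" using star J by (metis zero_less_mult_pos)
  then obtain d where d: "d > 0" "\<And>h. 0 < h \<Longrightarrow> h < d \<Longrightarrow> c (1 - h) \<bullet> c (1 - h) < z \<bullet> z"
    using DERIV_pos_inc_left[OF c2] c1 by auto
  have "open (f ` U)" using invariance_of_domain cont U inj by blast
  then obtain e where e: "e > 0" "ball (f z) e \<subseteq> f ` U" using U by (auto elim!: openE)
  have fz: "f z \<noteq> 0" using star by auto
  define \<delta> where "\<delta> = min d (e / norm (f z))"
  have "\<delta> > 0" using d e fz by (simp add: \<delta>_def)
  moreover have "of_real s * f z \<in> f ` (U \<inter> ball 0 (norm z))" if s: "1 - \<delta> < s" "s < 1" for s
  proof -
    have "norm (f z - of_real s * f z) = (1 - s) * norm (f z)"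
    proof -
      have "f z - of_real s * f z = of_real (1 - s) * f z" by (simp add: algebra_simps)
      then show ?thesis using s by (simp only: norm_mult norm_of_real)
    qed
    also have "\<dots> < e"
    proof -
      have "1 - s < e / norm (f z)" using s by (simp add: \<delta>_def)
      then show ?thesis using fz by (simp add: pos_less_divide_eq)
    qed
    finally have "of_real s * f z \<in> f ` U" using e(2) by (auto simp: dist_norm)
    then obtain x where x: "x \<in> U" "f x = of_real s * f z" by auto
    then have "c s = x" using \<phi>f by (metis c_def)
    moreover have "c s \<bullet> c s < z \<bullet> z" using d(2)[of "1 - s"] s by (simp add: \<delta>_def)
    ultimately have "norm x < norm z" by (simp add: norm_lt)
    then show ?thesis using x by (auto intro!: image_eqI[of _ _ x])
  qed
  ultimately show ?thesis by blast
qed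

lemma closed_left_extendable_interval:
  fixes T :: "real set"
  assumes "closed T" "1 \<in> T"
    and step: "\<And>t. t \<in> T \<Longrightarrow> 0 < t \<Longrightarrow> t \<le> 1 \<Longrightarrow> \<exists>e>0. \<forall>s. t - e < s \<and> s < t \<longrightarrow> s \<in> T"
  shows "{0<..1} \<subseteq> T"
proof (rule ccontr)
  assume "\<not> {0<..1} \<subseteq> T"
  then obtain u where u: "0 < u" "u \<le> 1" "u \<notin> T" by (auto simp: subset_eq)
  define t where "t = Inf (T \<inter> {u..1})"
  have "closed (T \<inter> {u..1})" using assms by (intro closed_Int) auto
  moreover have "T \<inter> {u..1} \<noteq> {}" "bdd_below (T \<inter> {u..1})" using assms u by auto
  ultimately have t: "t \<in> T \<inter> {u..1}" unfolding t_def by (intro closed_contains_Inf)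
  then have "u < t" using u by (cases "u = t") auto
  obtain e where e: "e > 0" "\<And>s. t - e < s \<Longrightarrow> s < t \<Longrightarrow> s \<in> T" using step[of t] t u by auto
  define s where "s = max ((u + t) / 2) (t - e / 2)"
  have s: "t - e < s" "s < t" "u \<le> s" "s \<le> 1" using e t \<open>u < t\<close> by (auto simp: s_def max_def)
  then have "s \<in> T \<inter> {u..1}" using e by auto
  then have "t \<le> s" unfolding t_def by (intro cInf_lower) auto
  then show False using s by simp
qed

lemma starlike_image_add_cnj:
  fixes f :: "complex \<Rightarrow> complex"
  assumes r: "r > 0" and f0: "f 0 = 0" and inj: "inj_on f (ball 0 r)"
    and D: "\<And>z. z \<in> ball 0 r \<Longrightarrow> (f has_derivative (\<lambda>v. a z * v + cnj (b z * v))) (at z)"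
    and less: "\<And>z. z \<in> ball 0 r \<Longrightarrow> norm (b z) < norm (a z)"
    and star: "\<And>z. z \<in> ball 0 r \<Longrightarrow> z \<noteq> 0 \<Longrightarrow> Re (f z * cnj (z * a z - cnj (z * b z))) > 0"
  shows "starlike_domain_wrt_0 (f ` ball 0 r)"
  unfolding starlike_domain_wrt_0_def
proof (intro conjI ballI)
  have cont: "continuous_on (ball 0 r) f"
    using D by (meson continuous_at_imp_continuous_on has_derivative_continuous)
  show "open (f ` ball 0 r)" using cont inj by (intro invariance_of_domain) auto
  show "connected (f ` ball 0 r)" using cont by (intro connected_continuous_image) auto
  show "0 \<in> f ` ball 0 r" using r f0 by (force intro: image_eqI[of _ _ 0])
  fix w assume "w \<in> f ` ball 0 r"
  then obtain z where z: "z \<in> ball 0 r" "w = f z" by auto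
  \<comment> \<open>Pass to the compact disk through \<open>z\<close>: the step lemma never leaves it, so the radial
    segment can only end at \<open>0\<close>.\<close>
  define K :: "complex set" where "K = cball 0 (norm z)"
  have K: "K \<subseteq> ball 0 r" using z by (auto simp: K_def)
  have "compact (f ` K)"
    using cont K by (intro compact_continuous_image) (auto simp: K_def intro: continuous_on_subset)
  then have "closed (f ` K)" by (rule compact_imp_closed)
  define T where "T = {t::real. of_real t * w \<in> f ` K}"
  have "closed T"
  proof -
    have "T = (\<lambda>t::real. of_real t * w) -` (f ` K)" by (auto simp: T_def)
    then show ?thesis using \<open>closed (f ` K)\<close>
      by (auto intro!: closed_vimage continuous_intros)
  qed
  have "1 \<in> T" using z by (auto simp: T_def K_def)
  have "{0<..1} \<subseteq> T"
  proof (rule closed_left_extendable_interval[OF \<open>closed T\<close> \<open>1 \<in> T\<close>])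
    fix t assume t: "t \<in> T" "0 < t" "t \<le> (1::real)"
    then obtain x where x: "x \<in> K" "of_real t * w = f x" by (auto simp: T_def)
    show "\<exists>e>0. \<forall>s. t - e < s \<and> s < t \<longrightarrow> s \<in> T"
    proof (cases "x = 0")
      case True
      then have "w = 0" using x f0 t by auto
      then have "T = UNIV" using x True f0 t by (auto simp: T_def)
      then show ?thesis by (auto intro: exI[of _ 1])
    next
      case False
      have xr: "x \<in> ball 0 r" using x K by auto
      obtain e where e: "e > 0"
        "\<And>s. 1 - e < s \<Longrightarrow> s < 1 \<Longrightarrow> of_real s * f x \<in> f ` (ball 0 r \<inter> ball 0 (norm x))"
        using radial_step_stays_in_disk[OF open_ball xr inj cont D[OF xr] less[OF xr] star[OF xr False]]
        by blast
      have "s \<in> T" if s: "t - t * e < s" "s < t" for s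
      proof -
        have "of_real (s / t) * f x \<in> f ` (ball 0 r \<inter> ball 0 (norm x))"
          using s t by (intro e) (auto simp: field_simps)
        moreover have "of_real (s / t) * f x = of_real s * w"
          using t by (simp add: x(2)[symmetric])
        moreover have "ball 0 (norm x) \<subseteq> K" using x by (auto simp: K_def)
        ultimately show ?thesis by (auto simp: T_def)
      qed
      then show ?thesis using e t by (intro exI[of _ "t * e"]) auto
    qed
  qed
  show "closed_segment 0 w \<subseteq> f ` ball 0 r"
  proof
    fix v assume "v \<in> closed_segment 0 w"
    then obtain u where u: "0 \<le> u" "u \<le> 1" "v = of_real u * w"
      by (auto simp: in_segment scaleR_conv_of_real)
    show "v \<in> f ` ball 0 r"
    proof (cases "u = 0")
      case True
      then show ?thesis using u \<open>0 \<in> f ` ball 0 r\<close> by simp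
    next
      case False
      then have "u \<in> T" using u \<open>{0<..1} \<subseteq> T\<close> by auto
      then show ?thesis using u K by (auto simp: T_def)
    qed
  qed
qed

section \<open>Starlike domains are close-to-convex\<close>

text \<open>The complement of a starlike domain is the union of its radial rays: on each direction the
  domain cuts out an initial interval, and radial rays of different directions do not meet.\<close>

lemma starlike_imp_close_to_convex_domain:
  assumes "starlike_domain_wrt_0 \<Omega>"
  shows "close_to_convex_domain \<Omega>"
proof -
  have op: "open \<Omega>" and con: "connected \<Omega>" and zero: "0 \<in> \<Omega>"
    and seg: "\<And>w. w \<in> \<Omega> \<Longrightarrow> closed_segment 0 w \<subseteq> \<Omega>"
    using assms by (auto simp: starlike_domain_wrt_0_def)
  have shrink: "of_real s * d \<in> \<Omega>" if "of_real t * d \<in> \<Omega>" "0 \<le> s" "s \<le> t" for s t d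
  proof (cases "t = 0")
    case True
    then show ?thesis using that zero by auto
  next
    case False
    then have "of_real s * d \<in> closed_segment 0 (of_real t * d)"
      using that unfolding in_segment
      by (intro exI[of _ "s / t"]) (auto simp: scaleR_conv_of_real field_simps)
    then show ?thesis using seg that by blast
  qed
  define L where "L = {(of_real t * d, d) | t d. norm d = 1 \<and> 0 < t \<and>
                         (\<forall>s\<ge>0. of_real s * d \<in> \<Omega> \<longleftrightarrow> s < t)}"
  have L_eq: "p = q" if pq: "(p, d) \<in> L" "(q, d) \<in> L" for p q d
  proof -
    obtain t u where "p = of_real t * d" "q = of_real u * d" "t > 0" "u > 0"
        "\<forall>s\<ge>0. of_real s * d \<in> \<Omega> \<longleftrightarrow> s < t" "\<forall>s\<ge>0. of_real s * d \<in> \<Omega> \<longleftrightarrow> s < u"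
      using pq unfolding L_def by blast
    then show ?thesis by (metis less_eq_real_def linorder_neqE less_irrefl)
  qed
  have dir: "d = w / of_real (norm w)" if pd: "(p, d) \<in> L" "w \<in> open_half_line p d" for p d w
  proof -
    obtain t u where t: "norm d = 1" "t > 0" "p = of_real t * d" "u > 0" "w = p + of_real u * d"
      using pd unfolding L_def open_half_line_def by blast
    then have "w = of_real (t + u) * d" by (simp add: algebra_simps)
    moreover from this have "norm w = t + u" using t by (simp only: norm_mult norm_of_real) simp
    ultimately show ?thesis using t by (auto simp: field_simps simp flip: of_real_add)
  qed
  have "disjoint_family_on (\<lambda>(p, d). open_half_line p d) L"
    unfolding disjoint_family_on_def
  proof (intro ballI impI)
    fix x y assume xy: "x \<in> L" "y \<in> L" "x \<noteq> y"
    obtain p d q e where eq: "x = (p, d)" "y = (q, e)" by (cases x, cases y)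
    have pq: "(p, d) \<in> L" "(q, e) \<in> L" "(p, d) \<noteq> (q, e)" using xy by (simp_all add: eq)
    have False if "w \<in> open_half_line p d" "w \<in> open_half_line q e" for w
      using pq dir[OF pq(1) that(1)] dir[OF pq(2) that(2)] L_eq by simp
    then show "(case x of (p, d) \<Rightarrow> open_half_line p d) \<inter> (case y of (p, d) \<Rightarrow> open_half_line p d) = {}"
      by (auto simp: eq)
  qed
  moreover have "- \<Omega> = (\<Union>(p, d)\<in>L. closed_half_line p d)"
  proof (intro equalityI subsetI)
    fix w assume w: "w \<in> - \<Omega>"
    then have "w \<noteq> 0" using zero by auto
    define d where "d = w / of_real (norm w)"
    have d: "norm d = 1" "w = of_real (norm w) * d"
      using \<open>w \<noteq> 0\<close> by (auto simp: d_def norm_divide)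
    define A where "A = {s::real. 0 \<le> s \<and> of_real s * d \<notin> \<Omega>}"
    define t where "t = Inf A"
    have A_eq: "A = {0..} \<inter> (\<lambda>s::real. of_real s * d) -` (- \<Omega>)" by (auto simp: A_def)
    have "closed A" unfolding A_eq
      using op by (intro closed_Int closed_vimage continuous_intros) auto
    moreover have wA: "norm w \<in> A" using w d by (simp add: A_def)
    moreover have bdd: "bdd_below A" unfolding A_def by (intro bdd_belowI[of _ 0]) auto
    ultimately have tA: "t \<in> A" unfolding t_def by (intro closed_contains_Inf) auto
    have tw: "t \<le> norm w" unfolding t_def using wA bdd by (rule cInf_lower)
    have "t > 0" using tA zero by (cases "t = 0") (auto simp: A_def)
    have "of_real s * d \<in> \<Omega> \<longleftrightarrow> s < t" if "s \<ge> 0" for s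
    proof
      assume "of_real s * d \<in> \<Omega>"
      then show "s < t" using shrink[of s d t] tA by (force simp: A_def)
    next
      assume "s < t"
      then have "s \<notin> A" using cInf_lower[OF _ bdd, of s] by (auto simp: t_def)
      then show "of_real s * d \<in> \<Omega>" using that by (auto simp: A_def)
    qed
    then have "(of_real t * d, d) \<in> L" using d \<open>t > 0\<close> by (auto simp: L_def)
    moreover have "w \<in> closed_half_line (of_real t * d) d"
    proof -
      have "w = of_real t * d + of_real (norm w - t) * d"
        using d(2) by (simp add: algebra_simps)
      then show ?thesis using tw unfolding closed_half_line_def by (smt (verit) mem_Collect_eq)
    qed
    ultimately show "w \<in> (\<Union>(p, d)\<in>L. closed_half_line p d)" by blast
  next
    fix w assume "w \<in> (\<Union>(p, d)\<in>L. closed_half_line p d)"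
    then obtain d t u where t: "t > 0" "\<forall>s\<ge>0. of_real s * d \<in> \<Omega> \<longleftrightarrow> s < t"
        "u \<ge> 0" "w = of_real t * d + of_real u * d"
      by (auto simp: L_def closed_half_line_def)
    then have "w = of_real (t + u) * d" "t + u \<ge> 0" by (auto simp: algebra_simps)
    then show "w \<in> - \<Omega>" using t by (metis ComplI add_le_same_cancel1 linorder_not_le le_add_same_cancel1)
  qed
  moreover have "\<forall>(p, d)\<in>L. norm d = 1" by (auto simp: L_def)
  ultimately show ?thesis
    unfolding close_to_convex_domain_def using op con zero by blast
qed

section \<open>Power series with small coefficients\<close>

lemma power_series_deriv_sums:
  fixes F :: "complex \<Rightarrow> complex"
  assumes F: "F holomorphic_on ball 0 r"
    and sums: "\<And>z. z \<in> ball 0 r \<Longrightarrow> (\<lambda>n. c n * z ^ (n + 2)) sums F z"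
    and z: "z \<in> ball 0 r"
  shows "(\<lambda>n. of_nat (n + 2) * c n * z ^ (n + 1)) sums deriv F z"
proof -
  define c' where "c' = (\<lambda>n. if n < 2 then 0 else c (n - 2))"
  have "(\<lambda>n. c' n * w ^ n) sums F w" if "norm w < r" for w
  proof -
    have "(\<lambda>n. c' (n + 2) * w ^ (n + 2)) sums F w" using sums that by (simp add: c'_def)
    then show ?thesis by (subst (asm) sums_zero_iff_shift) (auto simp: c'_def)
  qed
  moreover have "(F has_field_derivative deriv F z) (at z)"
    using F z by (auto intro: holomorphic_derivI)
  ultimately have "(\<lambda>n. diffs c' n * z ^ n) sums deriv F z"
    by (rule termdiffs_sums_strong) (use z in auto)
  then have "(\<lambda>n. diffs c' (n + 1) * z ^ (n + 1)) sums deriv F z"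
    by (subst sums_zero_iff_shift) (auto simp: c'_def diffs_def)
  then show ?thesis by (simp add: c'_def diffs_def algebra_simps)
qed

text \<open>With \<open>c\<^sub>n\<close> the coefficient of \<open>z\<^sup>n\<close> in \<open>F\<close>, the two norms in the second bound are
  \<open>\<bar>\<Sum>(n-1) c\<^sub>n z\<^sup>n\<bar>\<close> and \<open>\<bar>\<Sum>(n+1) c\<^sub>n z\<^sup>n\<bar>\<close>, so the triangle inequality bounds their sum by \<open>2\<Sum>n \<bar>c\<^sub>n\<bar> \<bar>z\<bar>\<^sup>n\<close>, the same majorant that controls the derivative.\<close>

lemma power_series_bounds:
  fixes F :: "complex \<Rightarrow> complex"
  assumes F: "F holomorphic_on ball 0 r"
    and sums: "\<And>z. z \<in> ball 0 r \<Longrightarrow> (\<lambda>n. c n * z ^ (n + 2)) sums F z"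
    and \<rho>: "\<rho> < r"
    and M: "(\<lambda>n. real (n + 2) * norm (c n) * \<rho> ^ (n + 1)) sums M"
  shows "\<And>z. norm z \<le> \<rho> \<Longrightarrow> norm (deriv F z) \<le> M"
    and "\<And>z. norm z = \<rho> \<Longrightarrow> norm (z * deriv F z - F z) + norm (z * deriv F z + F z) \<le> 2 * \<rho> * M"
proof -
  fix z :: complex assume z: "norm z \<le> \<rho>"
  show "norm (deriv F z) \<le> M"
  proof (rule norm_sums_le[OF power_series_deriv_sums[OF F sums] M])
    show "norm (of_nat (n + 2) * c n * z ^ (n + 1)) \<le> real (n + 2) * norm (c n) * \<rho> ^ (n + 1)" for n
      unfolding norm_mult norm_power norm_of_nat
      using z by (intro mult_left_mono power_mono) auto
  qed (use z \<rho> in auto)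
next
  fix z :: complex assume z: "norm z = \<rho>"
  then have \<rho>0: "\<rho> \<ge> 0" by auto
  have zr: "z \<in> ball 0 r" using z \<rho> by auto
  have M': "(\<lambda>n. real (n + 2) * norm (c n) * \<rho> ^ (n + 2)) sums (\<rho> * M)"
    using sums_mult[OF M, of \<rho>] by (simp add: algebra_simps)
  have "summable (\<lambda>n. norm (c n) * \<rho> ^ (n + 2))"
  proof (rule summable_comparison_test'[OF sums_summable[OF M']])
    fix n
    have "1 * (norm (c n) * \<rho> ^ (n + 2)) \<le> real (n + 2) * (norm (c n) * \<rho> ^ (n + 2))"
      using \<rho>0 by (intro mult_right_mono) auto
    then show "norm (norm (c n) * \<rho> ^ (n + 2)) \<le> real (n + 2) * norm (c n) * \<rho> ^ (n + 2)"
      using \<rho>0 by (simp add: mult.assoc abs_mult)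
  qed
  then obtain U where U: "(\<lambda>n. norm (c n) * \<rho> ^ (n + 2)) sums U" by (auto simp: summable_def)
  have zF': "(\<lambda>n. of_nat (n + 2) * c n * z ^ (n + 2)) sums (z * deriv F z)"
    using sums_mult[OF power_series_deriv_sums[OF F sums zr], of z] by (simp add: algebra_simps)
  have "norm (z * deriv F z - F z) \<le> \<rho> * M - U"
  proof (rule norm_sums_le[OF sums_diff[OF zF' sums[OF zr]] sums_diff[OF M' U]])
    fix n
    have "of_nat (n + 2) * c n * z ^ (n + 2) - c n * z ^ (n + 2) = of_nat (n + 1) * c n * z ^ (n + 2)"
      by (simp add: algebra_simps)
    moreover have "norm (of_nat (n + 1) * c n * z ^ (n + 2)) = real (n + 1) * norm (c n) * \<rho> ^ (n + 2)"
      unfolding norm_mult norm_power norm_of_nat z ..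
    ultimately show "norm (of_nat (n + 2) * c n * z ^ (n + 2) - c n * z ^ (n + 2))
        \<le> real (n + 2) * norm (c n) * \<rho> ^ (n + 2) - norm (c n) * \<rho> ^ (n + 2)"
      by (simp add: algebra_simps)
  qed
  moreover have "norm (z * deriv F z + F z) \<le> \<rho> * M + U"
  proof (rule norm_sums_le[OF sums_add[OF zF' sums[OF zr]] sums_add[OF M' U]])
    fix n
    show "norm (of_nat (n + 2) * c n * z ^ (n + 2) + c n * z ^ (n + 2))
        \<le> real (n + 2) * norm (c n) * \<rho> ^ (n + 2) + norm (c n) * \<rho> ^ (n + 2)"
      by (rule order.trans[OF norm_triangle_ineq])
         (simp only: norm_mult norm_power norm_of_nat z order.refl)
  qed
  ultimately show "norm (z * deriv F z - F z) + norm (z * deriv F z + F z) \<le> 2 * \<rho> * M" by simp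
qed

text \<open>Expanding the squares, \<open>4 Re (u cnj v) = \<bar>v + u\<bar>\<^sup>2 - \<bar>v - u\<bar>\<^sup>2\<close>. This lets the triangle
  inequality prove that \<open>f\<close> has increasing argument along circles: take \<open>u = f(z)\<close> and
  \<open>v = -\<i> \<partial>f/\<partial>\<theta>\<close>.\<close>

lemma Re_mult_cnj_pos:
  assumes "norm (v - u) < norm (v + u)"
  shows "Re (u * cnj v) > 0"
proof -
  have "(norm (v - u))\<^sup>2 < (norm (v + u))\<^sup>2" using assms by (intro power_strict_mono) auto
  then show ?thesis unfolding cmod_power2 by (simp add: power2_eq_square algebra_simps)
qed

text \<open>Write \<open>f = h + cnj g\<close> with \<open>h(z) = z + P(z)\<close> and \<open>g = Q\<close>. The majorant condition gives
  \<open>\<bar>P'\<bar> + \<bar>Q'\<bar> \<le> q < 1\<close> on each smaller disk, so \<open>f\<close> differs from the identity by a contraction and its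
  Jacobian \<open>\<bar>h'\<bar>\<^sup>2 - \<bar>g'\<bar>\<^sup>2\<close> is positive. The series for \<open>v \<plusminus> f\<close>, where \<open>v = z h' - cnj (z g')\<close>, have,
  beyond the leading term, coefficients weighted by \<open>n - 1\<close> or \<open>n + 1\<close>. These weights average to \<open>n\<close>, and so the same condition
  yields \<open>\<bar>v - f\<bar> < \<bar>v + f\<bar>\<close>.\<close>

theorem small_coefficients_imp_starlike:
  fixes P Q :: "complex \<Rightarrow> complex"
  assumes r: "r > 0"
    and P: "P holomorphic_on ball 0 r" and Q: "Q holomorphic_on ball 0 r"
    and P_sums: "\<And>z. z \<in> ball 0 r \<Longrightarrow> (\<lambda>n. \<alpha> n * z ^ (n + 2)) sums P z"
    and Q_sums: "\<And>z. z \<in> ball 0 r \<Longrightarrow> (\<lambda>n. \<beta> n * z ^ (n + 2)) sums Q z"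
    and small: "\<And>\<rho>. 0 \<le> \<rho> \<Longrightarrow> \<rho> < r \<Longrightarrow>
                  \<exists>s<1. (\<lambda>n. real (n + 2) * (norm (\<alpha> n) + norm (\<beta> n)) * \<rho> ^ (n + 1)) sums s"
  shows "starlike_in_disk (\<lambda>z. z + P z + cnj (Q z)) r"
proof -
  let ?f = "\<lambda>z. z + P z + cnj (Q z)"
  let ?a = "\<lambda>z. 1 + deriv P z" and ?b = "\<lambda>z. deriv Q z"
  have majorants: "\<exists>A B. A + B < 1 \<and> (\<lambda>n. real (n + 2) * norm (\<alpha> n) * \<rho> ^ (n + 1)) sums A \<and>
                    (\<lambda>n. real (n + 2) * norm (\<beta> n) * \<rho> ^ (n + 1)) sums B"
    if \<rho>: "0 \<le> \<rho>" "\<rho> < r" for \<rho>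
  proof -
    obtain s where s: "s < 1"
        "(\<lambda>n. real (n + 2) * (norm (\<alpha> n) + norm (\<beta> n)) * \<rho> ^ (n + 1)) sums s"
      using small[OF \<rho>] by auto
    have "summable (\<lambda>n. real (n + 2) * norm (\<alpha> n) * \<rho> ^ (n + 1))"
      using \<rho> by (intro summable_comparison_test'[OF sums_summable[OF s(2)]])
                 (auto intro!: mult_right_mono)
    moreover have "summable (\<lambda>n. real (n + 2) * norm (\<beta> n) * \<rho> ^ (n + 1))"
      using \<rho> by (intro summable_comparison_test'[OF sums_summable[OF s(2)]])
                 (auto intro!: mult_right_mono)
    ultimately obtain A B where AB: "(\<lambda>n. real (n + 2) * norm (\<alpha> n) * \<rho> ^ (n + 1)) sums A"
        "(\<lambda>n. real (n + 2) * norm (\<beta> n) * \<rho> ^ (n + 1)) sums B" by (auto simp: summable_def)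
    have "A + B = s"
      using sums_unique2[OF sums_add[OF AB]] s(2) by (simp add: algebra_simps)
    then show ?thesis using AB s(1) by blast
  qed
  have contraction: "\<exists>q<1. \<forall>z. norm z \<le> \<rho> \<longrightarrow> norm (deriv P z) + norm (deriv Q z) \<le> q"
    if \<rho>: "0 \<le> \<rho>" "\<rho> < r" for \<rho>
  proof -
    obtain A B where AB: "A + B < 1" "(\<lambda>n. real (n + 2) * norm (\<alpha> n) * \<rho> ^ (n + 1)) sums A"
        "(\<lambda>n. real (n + 2) * norm (\<beta> n) * \<rho> ^ (n + 1)) sums B" using majorants[OF \<rho>] by auto
    show ?thesis
      using AB(1) power_series_bounds(1)[OF P P_sums \<rho>(2) AB(2)]
        power_series_bounds(1)[OF Q Q_sums \<rho>(2) AB(3)]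
      by (intro exI[of _ "A + B"]) (auto intro: add_mono)
  qed
  have D: "(?f has_derivative (\<lambda>v. ?a z * v + cnj (?b z * v))) (at z)" if z: "z \<in> ball 0 r" for z
  proof (rule has_derivative_add_cnj)
    show "((\<lambda>z. z + P z) has_field_derivative 1 + deriv P z) (at z)"
      using P z by (intro DERIV_add DERIV_ident holomorphic_derivI) auto
    show "(Q has_field_derivative deriv Q z) (at z)"
      using Q z by (intro holomorphic_derivI) auto
  qed
  have less: "norm (?b z) < norm (?a z)" if z: "z \<in> ball 0 r" for z
  proof -
    have "norm (deriv P z) + norm (deriv Q z) < 1"
      using contraction[of "norm z"] z by force
    then show ?thesis using norm_diff_ineq[of 1 "deriv P z"] by simp
  qed
  have inj: "inj_on ?f (ball 0 r)"
  proof (rule inj_onI, rule ccontr)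
    fix x y assume xy: "x \<in> ball 0 r" "y \<in> ball 0 r" "?f x = ?f y" "x \<noteq> y"
    define \<rho> where "\<rho> = max (norm x) (norm y)"
    have \<rho>: "0 \<le> \<rho>" "\<rho> < r" using xy by (auto simp: \<rho>_def max_def)
    then obtain q where q: "q < 1" "\<And>z. norm z \<le> \<rho> \<Longrightarrow> norm (deriv P z) + norm (deriv Q z) \<le> q"
      using contraction by metis
    \<comment> \<open>\<open>f\<close> is the identity plus a contraction.\<close>
    let ?k = "\<lambda>z. P z + cnj (Q z)"
    have "norm (?k x - ?k y) \<le> q * norm (x - y)"
    proof (rule differentiable_bound[where S = "cball 0 \<rho>"])
      fix z :: complex assume z: "z \<in> cball 0 \<rho>"
      have "(?k has_derivative (\<lambda>v. deriv P z * v + cnj (deriv Q z * v))) (at z)"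
        using P Q z \<rho> by (intro has_derivative_add_cnj holomorphic_derivI) auto
      then show "(?k has_derivative (\<lambda>v. deriv P z * v + cnj (deriv Q z * v))) (at z within cball 0 \<rho>)"
        by (rule has_derivative_at_withinI)
      show "onorm (\<lambda>v. deriv P z * v + cnj (deriv Q z * v)) \<le> q"
      proof (rule onorm_le)
        fix v
        have "norm (deriv P z * v + cnj (deriv Q z * v)) \<le> norm (deriv P z * v) + norm (cnj (deriv Q z * v))"
          by (rule norm_triangle_ineq)
        also have "\<dots> = (norm (deriv P z) + norm (deriv Q z)) * norm v"
          by (simp only: complex_mod_cnj norm_mult distrib_right)
        also have "\<dots> \<le> q * norm v" using q(2)[of z] z by (intro mult_right_mono) auto
        finally show "norm (deriv P z * v + cnj (deriv Q z * v)) \<le> q * norm v" .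
      qed
    qed (auto simp: \<rho>_def)
    moreover have "?k x - ?k y = y - x" using xy(3) by (simp add: algebra_simps)
    ultimately have "norm (x - y) \<le> q * norm (x - y)" by (simp add: norm_minus_commute)
    then show False using q(1) xy(4) by simp
  qed
  have star: "Re (?f z * cnj (z * ?a z - cnj (z * ?b z))) > 0" if z: "z \<in> ball 0 r" "z \<noteq> 0" for z
  proof (rule Re_mult_cnj_pos)
    obtain A B where AB: "A + B < 1" "(\<lambda>n. real (n + 2) * norm (\<alpha> n) * norm z ^ (n + 1)) sums A"
        "(\<lambda>n. real (n + 2) * norm (\<beta> n) * norm z ^ (n + 1)) sums B"
      using majorants[of "norm z"] z by auto
    have zr: "norm z < r" using z by simp
    let ?P1 = "z * deriv P z - P z" and ?P2 = "z * deriv P z + P z"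
    let ?Q1 = "z * deriv Q z - Q z" and ?Q2 = "z * deriv Q z + Q z"
    have "norm ?P1 + norm ?P2 + (norm ?Q1 + norm ?Q2) \<le> 2 * norm z * A + 2 * norm z * B"
      using power_series_bounds(2)[OF P P_sums zr AB(2)] power_series_bounds(2)[OF Q Q_sums zr AB(3)]
      by (intro add_mono) auto
    also have "\<dots> = 2 * norm z * (A + B)" by (simp add: algebra_simps)
    also have "\<dots> < 2 * norm z * 1" using AB(1) z by (intro mult_strict_left_mono) auto
    finally have bound: "norm ?P1 + norm ?P2 + (norm ?Q1 + norm ?Q2) < norm (2 * z)"
      by (simp add: norm_mult)
    have "z * ?a z - cnj (z * ?b z) - ?f z = ?P1 - cnj ?Q2" by (simp add: algebra_simps)
    then have 1: "norm (z * ?a z - cnj (z * ?b z) - ?f z) \<le> norm ?P1 + norm ?Q2"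
      by (metis norm_triangle_ineq4 complex_mod_cnj)
    have "2 * z = z * ?a z - cnj (z * ?b z) + ?f z - (?P2 - cnj ?Q1)" by (simp add: algebra_simps)
    then have "norm (2 * z) \<le> norm (z * ?a z - cnj (z * ?b z) + ?f z) + norm (?P2 - cnj ?Q1)"
      by (metis norm_triangle_ineq4)
    moreover have "norm (?P2 - cnj ?Q1) \<le> norm ?P2 + norm ?Q1"
      by (metis norm_triangle_ineq4 complex_mod_cnj)
    ultimately show "norm (z * ?a z - cnj (z * ?b z) - ?f z) < norm (z * ?a z - cnj (z * ?b z) + ?f z)"
      using 1 bound by linarith
  qed
  have f0: "?f 0 = 0"
    using P_sums[of 0] Q_sums[of 0] r by (simp add: sums_iff)
  have "harmonic_fun_on ?f (ball 0 r)"
    using P Q by (intro harmonic_fun_on_add_cnj holomorphic_intros) auto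
  moreover have "sense_preserving_on ?f (ball 0 r)"
    using sense_preserving_add_cnj[OF D less] by (auto simp: sense_preserving_on_def)
  moreover have "starlike_domain_wrt_0 (?f ` ball 0 r)"
    by (rule starlike_image_add_cnj[OF r f0 inj D less star])
  ultimately show ?thesis
    using inj by (simp add: starlike_in_disk_def)
qed

section \<open>The radius\<close>

lemma sum_squares_sums:
  fixes x :: real
  assumes "\<bar>x\<bar> < 1"
  shows "(\<lambda>n. (real n + 1)\<^sup>2 * x ^ n) sums ((1 + x) / (1 - x) ^ 3)"
proof -
  have "(\<lambda>n. diffs real n * x ^ n) sums ((1 + x) / (1 - x) ^ 3)"
  proof (rule termdiffs_sums_strong)
    fix y :: real assume "norm y < 1"
    then have "(\<lambda>n. real (Suc n) * y ^ Suc n) sums (y / (1 - y)\<^sup>2)"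
      using sums_mult[OF geometric_deriv_sums[of y], of y] by (simp add: algebra_simps)
    then show "(\<lambda>n. real n * y ^ n) sums (y / (1 - y)\<^sup>2)"
      by (subst (asm) sums_Suc_iff) simp
  next
    have "1 - x \<noteq> 0" using assms by auto
    then show "((\<lambda>y. y / (1 - y)\<^sup>2) has_field_derivative (1 + x) / (1 - x) ^ 3) (at x)"
      by (auto intro!: derivative_eq_intros simp: divide_simps)
         (simp add: algebra_simps power2_eq_square power3_eq_cube power4_eq_xxxx)
  qed (use assms in auto)
  then show ?thesis by (simp add: diffs_def power2_eq_square algebra_simps)
qed

definition radius_cubic :: "real \<Rightarrow> real" where
  "radius_cubic x = 2 * x ^ 3 - 6 * x ^ 2 + 7 * x - 1"

lemma radius_cubic_strict_mono: "strict_mono radius_cubic"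
proof (rule strict_monoI)
  fix x y :: real assume "x < y"
  have "radius_cubic y - radius_cubic x =
          (y - x) * ((x + y - 2)\<^sup>2 + (x - 1)\<^sup>2 + (y - 1)\<^sup>2 + 1)"
    by (simp add: radius_cubic_def power2_eq_square power3_eq_cube algebra_simps)
  moreover have "(x + y - 2)\<^sup>2 + (x - 1)\<^sup>2 + (y - 1)\<^sup>2 + 1 > 0"
    by (intro add_nonneg_pos add_nonneg_nonneg) auto
  ultimately have "radius_cubic y - radius_cubic x > 0" using \<open>x < y\<close> by simp
  then show "radius_cubic x < radius_cubic y" by simp
qed

text \<open>Cardano's formula. In the variable \<open>x = r - 1\<close> the equation is \<open>2x\<^sup>3 + x + 2 = 0\<close>, whose real root is
  \<open>u - v\<close> with \<open>u\<^sup>3 - v\<^sup>3 = -1\<close> and \<open>u v = 1/6\<close>.\<close>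

lemma radius_cubic_r_S: "radius_cubic r_S = 0"
proof -
  have s: "sqrt 330 > 18" by (rule real_less_rsqrt) simp
  define c where "c = root 3 (- 18 + sqrt 330)"
  define k where "k = root 3 (6 :: real)"
  have c: "c > 0" "c ^ 3 = sqrt 330 - 18"
    unfolding c_def using s by (auto simp: real_root_gt_zero real_root_pow_pos2)
  have k: "k > 0" "k ^ 3 = 6" unfolding k_def by (auto simp: real_root_gt_zero real_root_pow_pos2)
  have k2: "(6::real) powr (2 / 3) = k\<^sup>2"
  proof -
    have "k = 6 powr (1 / 3)" unfolding k_def by (simp add: root_powr_inverse)
    then show ?thesis by (simp add: power2_eq_square flip: powr_add)
  qed
  define u where "u = c / k\<^sup>2"
  define v where "v = 1 / (k * c)"
  have rS: "r_S = 1 + u - v"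
    unfolding r_S_def u_def v_def k2 real_root_mult c_def[symmetric] k_def[symmetric] by simp
  have uv: "u * v = 1 / 6"
  proof -
    have "u * v = 1 / k ^ 3" using c k by (simp add: u_def v_def field_simps power2_eq_square power3_eq_cube)
    then show ?thesis using k by simp
  qed
  have "u ^ 3 = c ^ 3 / (k ^ 3)\<^sup>2" by (simp add: u_def power_divide flip: power_mult)
  then have u3: "u ^ 3 = (sqrt 330 - 18) / 36" using c k by simp
  have "v ^ 3 = 1 / (k ^ 3 * c ^ 3)" by (simp add: v_def power_divide power_mult_distrib)
  also have "\<dots> = (sqrt 330 + 18) / 36"
  proof -
    have "c ^ 3 * (sqrt 330 + 18) = 6" by (simp add: c(2) algebra_simps)
    then show ?thesis using c(1) k(2) by (simp add: field_simps)
  qed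
  finally have v3: "v ^ 3 = (sqrt 330 + 18) / 36" .
  have "radius_cubic r_S = 2 * (u ^ 3 - v ^ 3) + 2 + (u - v) * (1 - 6 * (u * v))"
    unfolding radius_cubic_def rS by (simp add: power2_eq_square power3_eq_cube algebra_simps)
  also have "\<dots> = 0" unfolding uv u3 v3 by (simp add: field_simps)
  finally show ?thesis .
qed

lemma radius_cubic_neg_iff: "radius_cubic x < 0 \<longleftrightarrow> x < r_S"
  using strict_mono_less[OF radius_cubic_strict_mono, of x r_S] by (simp add: radius_cubic_r_S)

lemma r_S_bounds: "0.1648775 < r_S" "r_S < 0.1648785"
proof -
  show "0.1648775 < r_S"
    by (subst radius_cubic_neg_iff[symmetric]) (simp add: radius_cubic_def field_simps)
  show "r_S < 0.1648785"
    using strict_mono_less[OF radius_cubic_strict_mono, of r_S "0.1648785"]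
    by (simp add: radius_cubic_r_S) (simp add: radius_cubic_def field_simps)
qed

lemma radius_cubic_root_iff: "2 * r ^ 3 - 6 * r ^ 2 + 7 * r - 1 = 0 \<longleftrightarrow> r = r_S"
  using strict_mono_eq[OF radius_cubic_strict_mono, of r r_S]
  by (simp add: radius_cubic_r_S) (simp add: radius_cubic_def)

text \<open>Since \<open>n (n + 1)/2 + n (n - 1)/2 = n\<^sup>2\<close>, the extremal coefficients satisfy
  \<open>\<Sum>n\<ge>2. n (\<bar>a\<^sub>n\<bar> + \<bar>b\<^sub>n\<bar>) \<rho>\<^sup>n\<^sup>-\<^sup>1 = (1 + \<rho>)/(1 - \<rho>)\<^sup>3 - 1\<close>, and this is less than \<open>1\<close> exactly
  when \<open>2(1 - \<rho>)\<^sup>3 - (1 + \<rho>)\<close>, the negative of the cubic, is positive.\<close>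

lemma extremal_majorant:
  assumes "0 \<le> \<rho>" "\<rho> < r_S"
  shows "\<exists>s<1. (\<lambda>n. (real n + 2)\<^sup>2 * \<rho> ^ (n + 1)) sums s"
proof -
  have \<rho>1: "\<rho> < 1" using assms r_S_bounds by simp
  have "(\<lambda>n. (real (Suc n) + 1)\<^sup>2 * \<rho> ^ Suc n) sums ((1 + \<rho>) / (1 - \<rho>) ^ 3 - 1)"
    using sum_squares_sums[of \<rho>] assms \<rho>1 by (subst sums_Suc_iff) simp
  then have "(\<lambda>n. (real n + 2)\<^sup>2 * \<rho> ^ (n + 1)) sums ((1 + \<rho>) / (1 - \<rho>) ^ 3 - 1)"
    by (simp add: algebra_simps)
  moreover have "(1 + \<rho>) / (1 - \<rho>) ^ 3 - 1 < 1"
  proof -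
    have "2 * (1 - \<rho>) ^ 3 - (1 + \<rho>) = - radius_cubic \<rho>"
      by (simp add: radius_cubic_def power2_eq_square power3_eq_cube algebra_simps)
    then have "1 + \<rho> < 2 * (1 - \<rho>) ^ 3" using assms radius_cubic_neg_iff[of \<rho>] by simp
    moreover have "(1 - \<rho>) ^ 3 > 0" using \<rho>1 by simp
    ultimately show ?thesis by (simp add: pos_divide_less_eq)
  qed
  ultimately show ?thesis by blast
qed

lemma coeff_bounded_pair_starlike:
  assumes "coeff_bounded_pair h g"
  shows "starlike_in_disk (\<lambda>z. h z + cnj (g z)) r_S"
proof -
  obtain a b :: "nat \<Rightarrow> complex" where a1: "a 1 = 1"
    and h: "h analytic_on ball 0 1" and g: "g analytic_on ball 0 1"
    and hs: "\<And>z. z \<in> ball 0 1 \<Longrightarrow> (\<lambda>n. a (Suc n) * z ^ Suc n) sums h z"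
    and gs: "\<And>z. z \<in> ball 0 1 \<Longrightarrow> (\<lambda>n. b (Suc n) * z ^ Suc n) sums g z"
    and ab: "\<And>n. n \<ge> 1 \<Longrightarrow> norm (a n) \<le> (real n + 1) / 2 \<and> norm (b n) \<le> (real n - 1) / 2"
    using assms unfolding coeff_bounded_pair_def by blast
  have b1: "b 1 = 0" using ab[of 1] by simp
  have sub: "ball 0 r_S \<subseteq> (ball 0 1 :: complex set)" using r_S_bounds by (intro subset_ball) simp
  have "starlike_in_disk (\<lambda>z. z + (h z - z) + cnj (g z)) r_S"
  proof (rule small_coefficients_imp_starlike)
    show "0 < r_S" using r_S_bounds by simp
    show "(\<lambda>z. h z - z) holomorphic_on ball 0 r_S" "g holomorphic_on ball 0 r_S"
      using h g sub
      by (auto intro!: holomorphic_intros intro: holomorphic_on_subset analytic_imp_holomorphic)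
    fix z :: complex assume "z \<in> ball 0 r_S"
    then have z: "z \<in> ball 0 1" using sub by auto
    have "(\<lambda>n. a (Suc (Suc n)) * z ^ Suc (Suc n)) sums (h z - z)"
      by (subst sums_Suc_iff) (use hs[OF z] a1 in simp)
    then show "(\<lambda>n. a (n + 2) * z ^ (n + 2)) sums (h z - z)" by simp
    have "(\<lambda>n. b (Suc (Suc n)) * z ^ Suc (Suc n)) sums g z"
      by (subst sums_Suc_iff) (use gs[OF z] b1 in simp)
    then show "(\<lambda>n. b (n + 2) * z ^ (n + 2)) sums g z" by simp
  next
    fix \<rho> assume \<rho>: "0 \<le> \<rho>" "\<rho> < r_S"
    obtain s where s: "s < 1" "(\<lambda>n. (real n + 2)\<^sup>2 * \<rho> ^ (n + 1)) sums s"
      using extremal_majorant[OF \<rho>] by auto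
    let ?u = "\<lambda>n. real (n + 2) * (norm (a (n + 2)) + norm (b (n + 2))) * \<rho> ^ (n + 1)"
    have le: "?u n \<le> (real n + 2)\<^sup>2 * \<rho> ^ (n + 1)" for n
    proof -
      have "norm (a (n + 2)) + norm (b (n + 2)) \<le> real n + 2" using ab[of "n + 2"] by simp
      then have "real (n + 2) * (norm (a (n + 2)) + norm (b (n + 2))) \<le> real (n + 2) * (real n + 2)"
        by (intro mult_left_mono) auto
      moreover have "(real n + 2)\<^sup>2 = real (n + 2) * (real n + 2)" by (simp add: power2_eq_square)
      ultimately show ?thesis using \<rho>(1) by (simp only: mult_right_mono zero_le_power)
    qed
    have "summable ?u"
      using le \<rho>(1) by (intro summable_comparison_test'[OF sums_summable[OF s(2)]]) auto
    then obtain t where t: "?u sums t" by (auto simp: summable_def)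
    have "t \<le> s" using sums_le[OF le t s(2)] .
    then show "\<exists>s<1. ?u sums s" using t s(1) by (intro exI[of _ t]) auto
  qed
  then show ?thesis by simp
qed

section \<open>Sharpness\<close>

text \<open>Closed forms of \<open>z - \<Sum>n\<ge>2. (n + 1)/2 z\<^sup>n\<close> and \<open>- \<Sum>n\<ge>1. (n - 1)/2 z\<^sup>n\<close>. Beyond the leading
  \<open>z\<close> the coefficients are negative of the largest admissible moduli, so that at positive \<open>z\<close> all these terms
  oppose \<open>z\<close>.\<close>

definition extremal_h :: "complex \<Rightarrow> complex" where
  "extremal_h z = 2 * z - (z / (1 - z)\<^sup>2 + z / (1 - z)) / 2"

definition extremal_g :: "complex \<Rightarrow> complex" where
  "extremal_g z = - (z / (1 - z)\<^sup>2 - z / (1 - z)) / 2"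

lemma extremal_coeff_bounded_pair: "coeff_bounded_pair extremal_h extremal_g"
proof -
  define a b :: "nat \<Rightarrow> complex"
    where "a = (\<lambda>n. if n = 1 then 1 else - (of_nat n + 1) / 2)"
      and "b = (\<lambda>n. - (of_nat n - 1) / 2)"
  have ne: "1 - z \<noteq> 0" if "z \<in> ball 0 1" for z :: complex using that by auto
  have "extremal_h analytic_on ball 0 1" "extremal_g analytic_on ball 0 1"
    unfolding extremal_h_def extremal_g_def using ne by (auto intro!: analytic_intros)
  moreover have "(\<lambda>n. a (Suc n) * z ^ Suc n) sums extremal_h z \<and>
                 (\<lambda>n. b (Suc n) * z ^ Suc n) sums extremal_g z" if "z \<in> ball 0 1" for z
  proof -
    have z: "norm z < 1" using that by simp
    have D: "(\<lambda>n. z * (of_nat (Suc n) * z ^ n)) sums (z / (1 - z)\<^sup>2)"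
      using sums_mult[OF geometric_deriv_sums[OF z], of z] by simp
    have G: "(\<lambda>n. z * z ^ n) sums (z / (1 - z))"
      using sums_mult[OF geometric_sums[OF z], of z] by simp
    have "(\<lambda>n. (if n = 0 then 2 * z else 0) - (z * (of_nat (Suc n) * z ^ n) + z * z ^ n) / 2)
            sums extremal_h z"
      unfolding extremal_h_def
      by (intro sums_diff sums_divide sums_add D G sums_single[of 0 "\<lambda>_. 2 * z"])
    moreover have "(if n = 0 then 2 * z else 0) - (z * (of_nat (Suc n) * z ^ n) + z * z ^ n) / 2 =
        a (Suc n) * z ^ Suc n" for n
      by (cases "n = 0") (auto simp: a_def field_simps)
    moreover have "(\<lambda>n. - (z * (of_nat (Suc n) * z ^ n) - z * z ^ n) / 2) sums extremal_g z"
      unfolding extremal_g_def by (intro sums_divide sums_minus sums_diff D G)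
    moreover have "- (z * (of_nat (Suc n) * z ^ n) - z * z ^ n) / 2 = b (Suc n) * z ^ Suc n" for n
      by (auto simp: b_def field_simps)
    ultimately show ?thesis by simp
  qed
  moreover have "norm (a n) \<le> (real n + 1) / 2 \<and> norm (b n) \<le> (real n - 1) / 2" if n: "n \<ge> 1" for n
  proof -
    have "- (of_nat n + 1) / 2 = (- of_nat (Suc n) / 2 :: complex)" by simp
    then have "norm (- (of_nat n + 1) / 2 :: complex) = (real n + 1) / 2"
      by (simp only: norm_divide norm_minus_cancel norm_of_nat) simp
    moreover have "norm (b n) = (real n - 1) / 2"
      using n norm_of_nat[of "n - 1", where 'a = complex]
      by (simp add: b_def norm_divide norm_minus_commute of_nat_diff del: norm_of_nat)
    ultimately show ?thesis by (auto simp: a_def)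
  qed
  ultimately show ?thesis
    unfolding coeff_bounded_pair_def by (intro conjI exI[of _ a] exI[of _ b]) (auto simp: a_def)
qed

text \<open>On the real axis the extremal map is \<open>2x - x/(1 - x)\<^sup>2\<close>, whose derivative
  \<open>2 - (1 + x)/(1 - x)\<^sup>3\<close> changes sign at the radius. Dividing the difference of two values
  by \<open>x - y\<close> shows that two distinct points of \<open>[0, 1)\<close> share a value iff \<open>1 - x y = 2(1 - x)\<^sup>2(1 - y)\<^sup>2\<close>. This holds
  when \<open>x\<close> and \<open>y\<close> both equal the radius. When \<open>x\<close> moves slightly to the right, the intermediate value
  theorem provides a matching \<open>y\<close> on the left.\<close>

lemma extremal_not_inj:
  assumes r: "r_S < r" "r \<le> 1"
  shows "\<not> inj_on (\<lambda>z. extremal_h z + cnj (extremal_g z)) (ball 0 r)"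
proof -
  let ?f = "\<lambda>z. extremal_h z + cnj (extremal_g z)"
  have real_value: "?f (of_real x) = of_real (2 * x - x / (1 - x)\<^sup>2)" for x :: real
    by (simp add: extremal_h_def extremal_g_def field_simps)
  \<comment> \<open>The bound \<open>0.29 < 1 - 1/\<surd>2\<close> makes \<open>\<phi>\<close> negative at \<open>0\<close>.\<close>
  define x where "x = min ((r_S + r) / 2) 0.29"
  have x: "r_S < x" "x < r" "x \<le> 0.29" using r r_S_bounds by (auto simp: x_def min_def)
  define \<phi> where "\<phi> = (\<lambda>y. (1 - x * y) - 2 * (1 - x)\<^sup>2 * (1 - y)\<^sup>2)"
  have "2 * (1 - r_S) ^ 3 - (1 + r_S) = - radius_cubic r_S"
    by (simp add: radius_cubic_def power2_eq_square power3_eq_cube algebra_simps)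
  then have "(2 * (1 - r_S) ^ 3) * (1 - r_S) = (1 + r_S) * (1 - r_S)" by (simp add: radius_cubic_r_S)
  then have diag: "2 * (1 - r_S) ^ 4 = 1 - r_S\<^sup>2"
    by (simp add: power2_eq_square power3_eq_cube power4_eq_xxxx algebra_simps)
  have "\<phi> r_S = (x - r_S) * (2 * (1 - r_S)\<^sup>2 * (2 - r_S - x) - r_S) + (1 - r_S\<^sup>2 - 2 * (1 - r_S) ^ 4)"
    by (simp add: \<phi>_def power2_eq_square power4_eq_xxxx algebra_simps)
  moreover have "2 * (1 - r_S)\<^sup>2 * (2 - r_S - x) - r_S > 0"
  proof -
    have "(0.8::real)\<^sup>2 \<le> (1 - r_S)\<^sup>2" using r_S_bounds by (intro power_mono) auto
    then have "1 * 1 \<le> (2 * (1 - r_S)\<^sup>2) * (2 - r_S - x)"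
      using r_S_bounds x by (intro mult_mono) (auto simp: power2_eq_square)
    moreover have "r_S < 1" using r_S_bounds by simp
    ultimately show ?thesis by linarith
  qed
  ultimately have "\<phi> r_S \<ge> 0" using x diag by simp
  moreover have "\<phi> 0 \<le> 0"
  proof -
    have "(0.71::real)\<^sup>2 \<le> (1 - x)\<^sup>2" using x by (intro power_mono) auto
    then show ?thesis by (simp add: \<phi>_def power2_eq_square)
  qed
  ultimately obtain y where y: "0 \<le> y" "y \<le> r_S" "\<phi> y = 0"
    using IVT'[of \<phi> 0 0 r_S] r_S_bounds by (force simp: \<phi>_def intro!: continuous_intros)
  have ne: "(1 - x)\<^sup>2 \<noteq> 0" "(1 - y)\<^sup>2 \<noteq> 0" using x y r_S_bounds by auto
  have "x / (1 - x)\<^sup>2 - y / (1 - y)\<^sup>2 = (x - y) * (1 - x * y) / ((1 - x)\<^sup>2 * (1 - y)\<^sup>2)"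
    using ne by (simp add: diff_frac_eq) (simp add: power2_eq_square algebra_simps)
  also have "1 - x * y = 2 * ((1 - x)\<^sup>2 * (1 - y)\<^sup>2)" using y(3) by (simp add: \<phi>_def)
  also have "(x - y) * \<dots> / ((1 - x)\<^sup>2 * (1 - y)\<^sup>2) = 2 * (x - y)" using ne by simp
  finally have "2 * x - x / (1 - x)\<^sup>2 = 2 * y - y / (1 - y)\<^sup>2" by simp
  then have "?f (of_real x) = ?f (of_real y)" by (simp only: real_value)
  moreover have "complex_of_real x \<noteq> of_real y" using x y by simp
  moreover have "complex_of_real x \<in> ball 0 r" "complex_of_real y \<in> ball 0 r"
    using x y r_S_bounds by auto
  ultimately show ?thesis by (meson inj_onD)
qed

theorem theorem1p9:
  shows "(\<forall>h g :: complex \<Rightarrow> complex. coeff_bounded_pair h g \<longrightarrow>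
            close_to_convex_in_disk (\<lambda>z. h z + cnj (g z)) r_S \<and>
            starlike_in_disk (\<lambda>z. h z + cnj (g z)) r_S)
       \<and> {r::real. 0 < r \<and> r < 1 \<and> 2 * r ^ 3 - 6 * r ^ 2 + 7 * r - 1 = 0} = {r_S}
       \<and> \<bar>r_S - 0.164878\<bar> < 5 / 10 ^ 7
       \<and> (\<forall>r::real. r_S < r \<and> r \<le> 1 \<longrightarrow>
            (\<exists>h g :: complex \<Rightarrow> complex. coeff_bounded_pair h g \<and>
               \<not> inj_on (\<lambda>z. h z + cnj (g z)) (ball 0 r)))"
proof (intro conjI allI impI)
  fix h g :: "complex \<Rightarrow> complex" assume hg: "coeff_bounded_pair h g"
  show "starlike_in_disk (\<lambda>z. h z + cnj (g z)) r_S"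
    using hg by (rule coeff_bounded_pair_starlike)
  then show "close_to_convex_in_disk (\<lambda>z. h z + cnj (g z)) r_S"
    unfolding starlike_in_disk_def close_to_convex_in_disk_def
    using starlike_imp_close_to_convex_domain by blast
next
  show "{r::real. 0 < r \<and> r < 1 \<and> 2 * r ^ 3 - 6 * r ^ 2 + 7 * r - 1 = 0} = {r_S}"
    unfolding radius_cubic_root_iff using r_S_bounds by auto
  show "\<bar>r_S - 0.164878\<bar> < 5 / 10 ^ 7"
    unfolding abs_less_iff using r_S_bounds by simp
next
  fix r :: real assume "r_S < r \<and> r \<le> 1"
  then show "\<exists>h g :: complex \<Rightarrow> complex. coeff_bounded_pair h g \<and>
               \<not> inj_on (\<lambda>z. h z + cnj (g z)) (ball 0 r)"
    using extremal_coeff_bounded_pair extremal_not_inj by blast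
qed

end
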